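(* Let $w$ be an infinite word (over a finite alphabet) of unbounded exponent. Then $w$ is not infinite closed-rich.
   Context: Infinite words are one-sided sequences over a finite alphabet. A factor of a word is a contiguous finite subword. A period of a finite word $v=v_0\cdots v_{m-1}$ is an integer $t\ge 1$ with $v_{i+t}=v_i$ for all $0\le i<m-t$; the exponent of a non-empty finite word $v$ is $|v|/t$ where $t$ is its shortest period. The exponent of an infinite word is the supremum of the exponents of its non-empty factors; it is unbounded if this supremum is infinite. A border of a finite word $v$ is a proper prefix of $v$ which is also a suffix of $v$. A finite word $v$ is closed if $|v|\le 1$, or if $|v|\ge 2$ and the longest border of $v$ is non-empty and occurs in $v$ exactly twice (as a prefix and as a suffix). An infinite word $w$ is (infinite) closed-rich if there exists a constant $C>0$ such that for each $n\in\mathbb{N}$ each factor of $w$ of length $n$ contains at least $Cn^2$ distinct closed factors. *)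

theory Defs
  imports
    Complex_Main
    "HOL-Library.Extended_Real"
    "HOL-Library.Omega_Words_Fun"
    "HOL-Library.Sublist"
begin

(* Finite words are lists; infinite words are functions on the naturals ("'a word" from
   Omega_Words_Fun).  On finite words, contiguous factor is Sublist.sublist, and the unqualified
   prefix and suffix below are the list relations of Sublist, not their omega-word namesakes. *)

definition word_factor :: "'a list \<Rightarrow> 'a word \<Rightarrow> bool" where
  "word_factor u w \<longleftrightarrow> (\<exists>i j. i \<le> j \<and> u = subsequence w i j)"

definition is_period :: "nat \<Rightarrow> 'a list \<Rightarrow> bool" where
  "is_period t v \<longleftrightarrow> t \<ge> 1 \<and> (\<forall>i. i + t < length v \<longrightarrow> v ! (i + t) = v ! i)"

definition shortest_period :: "'a list \<Rightarrow> nat" where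
  "shortest_period v = (LEAST t. is_period t v)"

(* Intended for non-empty words only. *)
definition exponent :: "'a list \<Rightarrow> real" where
  "exponent v = real (length v) / real (shortest_period v)"

definition word_exponent :: "'a word \<Rightarrow> ereal" where
  "word_exponent w = (SUP u \<in> {u. word_factor u w \<and> u \<noteq> []}. ereal (exponent u))"

definition unbounded_exponent :: "'a word \<Rightarrow> bool" where
  "unbounded_exponent w \<longleftrightarrow> word_exponent w = \<infinity>"

(* The empty word is a border of every non-empty word. *)
definition is_border :: "'a list \<Rightarrow> 'a list \<Rightarrow> bool" where
  "is_border b v \<longleftrightarrow> strict_prefix b v \<and> suffix b v"

definition longest_border :: "'a list \<Rightarrow> 'a list" where
  "longest_border v = (ARG_MAX length b. is_border b v)"

(* Starting positions; occurrences may overlap. *)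
definition occurrences :: "'a list \<Rightarrow> 'a list \<Rightarrow> nat set" where
  "occurrences b v = {i. i + length b \<le> length v \<and> take (length b) (drop i v) = b}"

(* A border b occurs in v as a prefix and, at a different position, as a suffix, so card = 2
   says that there is no further occurrence. *)
definition closed_word :: "'a list \<Rightarrow> bool" where
  "closed_word v \<longleftrightarrow>
     length v \<le> 1 \<or>
     (length v \<ge> 2 \<and> longest_border v \<noteq> [] \<and> card (occurrences (longest_border v) v) = 2)"

definition closed_factors :: "'a list \<Rightarrow> 'a list set" where
  "closed_factors v = {u. sublist u v \<and> closed_word u}"

definition closed_rich :: "'a word \<Rightarrow> bool" where
  "closed_rich w \<longleftrightarrow>
     (\<exists>C::real. C > 0 \<and>
        (\<forall>n v. word_factor v w \<and> length v = n \<longrightarrow>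
           real (card (closed_factors v)) \<ge> C * (real n)\<^sup>2))"

(* The definite descriptions and cardinalities above are meaningful: the shortest period exists,
   the longest border of a non-empty word is attained and unique, and the counted sets are finite. *)

lemma is_period_shortest_period: "is_period (shortest_period v) v"
proof -
  have "is_period (Suc (length v)) v" by (simp add: is_period_def)
  then show ?thesis unfolding shortest_period_def by (rule LeastI)
qed

lemma longest_border:
  assumes "v \<noteq> []"
  shows "is_border (longest_border v) v"
    and "is_border b v \<Longrightarrow> length b \<le> length (longest_border v)"
    and "is_border b v \<Longrightarrow> length b = length (longest_border v) \<Longrightarrow> b = longest_border v"
proof -
  have ex: "is_border [] v" using assms by (simp add: is_border_def strict_prefix_def)
  have bd: "\<forall>b. is_border b v \<longrightarrow> length b < Suc (length v)"
    by (auto simp: is_border_def strict_prefix_def less_Suc_eq_le dest: prefix_length_le)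
  show *: "is_border (longest_border v) v"
    unfolding longest_border_def using arg_max_natI[of "\<lambda>b. is_border b v", OF ex] bd by blast
  show "is_border b v \<Longrightarrow> length b \<le> length (longest_border v)"
    unfolding longest_border_def
    using arg_max_nat_le[of "\<lambda>b. is_border b v" b length] bd by blast
  show "is_border b v \<Longrightarrow> length b = length (longest_border v) \<Longrightarrow> b = longest_border v"
    using * by (auto simp: is_border_def strict_prefix_def prefix_def)
qed

lemma finite_occurrences: "finite (occurrences b v)"
  by (rule finite_subset[of _ "{..length v}"]) (auto simp: occurrences_def)

lemma finite_closed_factors: "finite (closed_factors v)"
  by (rule finite_subset[of _ "set (sublists v)"]) (auto simp: closed_factors_def)

end

theory Submission
  imports Defs
begin

text \<open>
  A finite word of length \<open>n\<close> with period \<open>p\<close> has at most \<open>p\<close> distinct factors of each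
  length, since a starting position matters only modulo \<open>p\<close>. So it has at most
  \<open>p * (n + 1) \<le> 2 * n\<^sup>2 / (n / p)\<close> factors, closed or not, and a bound
  \<open>C * n\<^sup>2\<close> from below forces every exponent \<open>n / p\<close> to be at most \<open>2 / C\<close>.
\<close>

text \<open>Strong induction on \<open>i\<close>: for \<open>i \<ge> p\<close>, stepping back by
  \<open>p\<close> keeps the index inside \<open>v\<close> and preserves its residue.\<close>

lemma is_period_nth_mod:
  assumes "is_period p v" and "i < length v"
  shows "v ! i = v ! (i mod p)"
  using assms(2)
proof (induction i rule: less_induct)
  case (less i)
  show ?case
  proof (cases "i < p")
    case False
    have "p \<ge> 1" and step: "\<And>j. j + p < length v \<Longrightarrow> v ! (j + p) = v ! j"
      using assms(1) by (auto simp: is_period_def)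
    with False less.IH[of "i - p"] less.prems step[of "i - p"] show ?thesis
      by (simp add: le_mod_geq)
  qed simp
qed

text \<open>Replacing the start of an occurrence by its residue modulo \<open>p\<close> moves the
  window to the left, so it still fits into \<open>v\<close>, and periodicity keeps its
  letters.\<close>

lemma sublist_is_period_start:
  assumes "is_period p v" and "sublist u v"
  obtains i where "i < p" and "u = take (length u) (drop i v)"
proof -
  obtain xs ys where v: "v = xs @ u @ ys"
    using assms(2) by (auto simp: sublist_def)
  define s where "s = length xs"
  have p: "p \<ge> 1"
    using assms(1) by (simp add: is_period_def)
  have "s mod p \<le> s" and s: "s + length u \<le> length v"
    by (auto simp: v s_def)
  then have r: "s mod p + length u \<le> length v"
    by linarith
  have "u = take (length u) (drop (s mod p) v)"
  proof (rule nth_equalityI)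
    show "length u = length (take (length u) (drop (s mod p) v))"
      using r by simp
  next
    fix k assume k: "k < length u"
    have "u ! k = v ! (s + k)"
      using k by (simp add: v s_def nth_append)
    \<comment> \<open>\<open>s + k\<close> and \<open>s mod p + k\<close> are both valid indices
      with the same residue, so the letter at that residue links them.\<close>
    also have "\<dots> = v ! ((s + k) mod p)"
      using s k by (intro is_period_nth_mod assms) simp
    also have "\<dots> = v ! ((s mod p + k) mod p)"
      by (simp add: mod_add_left_eq)
    also have "\<dots> = v ! (s mod p + k)"
      using r k by (intro is_period_nth_mod[symmetric] assms) simp
    also have "\<dots> = take (length u) (drop (s mod p) v) ! k"
      using r k by simp
    finally show "u ! k = take (length u) (drop (s mod p) v) ! k" .
  qed
  then show thesis
    using that[of "s mod p"] p by simp
qed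

text \<open>Pairs of a start below \<open>p\<close> and a length from 0 to \<open>length v\<close>
  cover all factors; the \<open>+ 1\<close> accounts for length 0.\<close>

lemma card_sublists_le_period:
  assumes "is_period p v"
  shows "card {u. sublist u v} \<le> p * (length v + 1)"
proof -
  let ?I = "{..<p} \<times> {..length v}"
  have "{u. sublist u v} \<subseteq> (\<lambda>(i, m). take m (drop i v)) ` ?I"
  proof
    fix u assume "u \<in> {u. sublist u v}"
    then have u: "sublist u v" by simp
    obtain i where "i < p" "u = take (length u) (drop i v)"
      using sublist_is_period_start[OF assms u] .
    moreover have "length u \<le> length v"
      using u by (rule sublist_length_le)
    ultimately show "u \<in> (\<lambda>(i, m). take m (drop i v)) ` ?I"
      by (intro image_eqI[of _ _ "(i, length u)"]) auto
  qed
  then have "card {u. sublist u v} \<le> card ?I"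
    by (rule surj_card_le[rotated]) simp
  then show ?thesis by simp
qed

lemma card_closed_factors_le:
  "card (closed_factors v) \<le> shortest_period v * (length v + 1)"
proof -
  have "finite {u. sublist u v}"
    by (rule finite_subset[of _ "set (sublists v)"]) auto
  then have "card (closed_factors v) \<le> card {u. sublist u v}"
    by (rule card_mono) (auto simp: closed_factors_def)
  also have "\<dots> \<le> shortest_period v * (length v + 1)"
    by (rule card_sublists_le_period[OF is_period_shortest_period])
  finally show ?thesis .
qed

lemma exponent_le_if_many_closed_factors:
  assumes "C > 0" and "v \<noteq> []"
    and "real (card (closed_factors v)) \<ge> C * (real (length v))\<^sup>2"
  shows "exponent v \<le> 2 / C"
proof -
  define n p where "n = length v" and "p = shortest_period v"
  have n: "real n \<ge> 1"
    using assms(2) by (cases v) (auto simp: n_def)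
  have p: "real p \<ge> 1"
    using is_period_shortest_period[of v] by (simp add: is_period_def p_def)
  have "C * (real n)\<^sup>2 \<le> real (p * (n + 1))"
    using assms(3) card_closed_factors_le[of v] unfolding n_def p_def by linarith
  \<comment> \<open>Since \<open>v\<close> is non-empty, \<open>n + 1 \<le> 2 * n\<close>; this is
    the source of the 2 in \<open>2 / C\<close> and allows cancelling \<open>n\<close>
    below.\<close>
  also have "\<dots> \<le> real p * (2 * real n)"
    unfolding of_nat_mult using n by (intro mult_left_mono) auto
  finally have "(C * real n) * real n \<le> (2 * real p) * real n"
    by (simp add: power2_eq_square ac_simps)
  then have "C * real n \<le> 2 * real p"
    using n by (simp add: mult_le_cancel_right)
  then show ?thesis
    using assms(1) p by (simp add: exponent_def field_simps flip: n_def p_def)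
qed

theorem proposition5:
  fixes A :: "'a set" and w :: "'a word"
  assumes "finite A"
    and "range w \<subseteq> A"
    and "unbounded_exponent w"
  shows "\<not> closed_rich w"
proof
  assume "closed_rich w"
  then obtain C :: real where C: "C > 0"
    and many: "\<And>v. word_factor v w \<Longrightarrow> real (card (closed_factors v)) \<ge> C * (real (length v))\<^sup>2"
    unfolding closed_rich_def by blast
  \<comment> \<open>\<open>C\<close> is the same for all factors, so one real number bounds the
    whole supremum.\<close>
  have "word_exponent w \<le> ereal (2 / C)"
    unfolding word_exponent_def
    by (rule SUP_least) (auto intro: exponent_le_if_many_closed_factors[OF C] many)
  with assms(3) show False
    by (simp add: unbounded_exponent_def)
qed

end
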